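(* Let $\mathcal{H}$ be a complex Hilbert space, let $A\in\mathcal{B}(\mathcal{H})$ be a positive operator, let $B=\begin{pmatrix} A & O \\ O & A \end{pmatrix}$ on $\mathcal{H}\oplus\mathcal{H}$, and let $X,Y,Z,W\in\mathcal{B}_A(\mathcal{H})$. Then $$\begin{aligned} w_B^2\begin{pmatrix} X & Y \\ Z & W \end{pmatrix}\le{}&\max\{w_A^2(X),w_A^2(W)\}+w_B^2\begin{pmatrix} O & Y \\ Z & O \end{pmatrix}+w_B\begin{pmatrix} O & Z^{\sharp_A}W \\ Y^{\sharp_A}X & O \end{pmatrix} \\ &+\frac12\max\left\{\|X^{\sharp_A}X+Z^{\sharp_A}Z\|_A,\ \|W^{\sharp_A}W+Y^{\sharp_A}Y\|_A\right\}.\end{aligned}$$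
   Context: $\mathcal{H}$ is a complex Hilbert space with inner product $\langle\cdot,\cdot\rangle$ (linear in the first variable), $\mathcal{B}(\mathcal{H})$ is the algebra of bounded linear operators on $\mathcal{H}$, $O$ is the zero operator, and $A\in\mathcal{B}(\mathcal{H})$ is a positive operator (i.e. $\langle Ax,x\rangle\ge 0$ for all $x$; not necessarily injective or with closed range). Put $\langle x,y\rangle_A=\langle Ax,y\rangle$ and $\|x\|_A=\sqrt{\langle x,x\rangle_A}$. An operator $R\in\mathcal{B}(\mathcal{H})$ is an $A$-adjoint of $T\in\mathcal{B}(\mathcal{H})$ if $\langle Tx,y\rangle_A=\langle x,Ry\rangle_A$ for all $x,y\in\mathcal{H}$. $\mathcal{B}_A(\mathcal{H})$ is the set of all $T\in\mathcal{B}(\mathcal{H})$ admitting an $A$-adjoint; equivalently, $R(T^*A)\subseteq R(A)$, where $R(\cdot)$ denotes range. For $T\in\mathcal{B}_A(\mathcal{H})$, $T^{\sharp_A}$ denotes the unique $A$-adjoint with range contained in $\overline{R(A)}$, i.e. the unique solution $S$ of $AS=T^*A$ with $R(S)\subseteq\overline{R(A)}$. For $T\in\mathcal{B}_A(\mathcal{H})$, the $A$-operator seminorm is $\|T\|_A=\sup\{\|Tx\|_A: x\in\mathcal{H},\ \|x\|_A=1\}$ and the $A$-numerical radius is $w_A(T)=\sup\{|\langle Tx,x\rangle_A|: x\in\mathcal{H},\ \|x\|_A=1\}$. The operator $B$ is positive on the Hilbert space $\mathcal{H}\oplus\mathcal{H}$, and $\langle\cdot,\cdot\rangle_B$, $\|\cdot\|_B$,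 $w_B(\cdot)$ are defined by the same formulas with $(\mathcal{H},A)$ replaced by $(\mathcal{H}\oplus\mathcal{H},B)$; $2\times2$ operator matrices with entries in $\mathcal{B}_A(\mathcal{H})$ act on $\mathcal{H}\oplus\mathcal{H}$ in the usual way (and belong to $\mathcal{B}_B(\mathcal{H}\oplus\mathcal{H})$). Write $w_A^2(T)=(w_A(T))^2$ and similarly $w_B^2$. *)

theory Defs
  imports "HOL-Analysis.Analysis"
begin

(* The real structure inherited from real_inner (scaleR, inner, norm, topology) is tied to the
   complex one by the axioms scaleR_scaleC and inner_eq_Re_cinner, so norm x is the square root
   of cinner x x, and positive definiteness of cinner comes from that of inner. *)
class complex_inner = real_inner +
  fixes scaleC :: "complex \<Rightarrow> 'a \<Rightarrow> 'a" (infixr "*\<^sub>C" 75)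
    and cinner :: "'a \<Rightarrow> 'a \<Rightarrow> complex"
  assumes scaleC_add_right: "c *\<^sub>C (x + y) = c *\<^sub>C x + c *\<^sub>C y"
    and scaleC_add_left: "(c + d) *\<^sub>C x = c *\<^sub>C x + d *\<^sub>C x"
    and scaleC_scaleC: "c *\<^sub>C (d *\<^sub>C x) = (c * d) *\<^sub>C x"
    and scaleC_one: "1 *\<^sub>C x = x"
    and scaleR_scaleC: "r *\<^sub>R x = complex_of_real r *\<^sub>C x"
    and cinner_commute: "cinner x y = cnj (cinner y x)"
    and cinner_add_left: "cinner (x + y) z = cinner x z + cinner y z"
    and cinner_scaleC_left: "cinner (c *\<^sub>C x) y = c * cinner x y"
    and inner_eq_Re_cinner: "inner x y = Re (cinner x y)"

class complex_hilbert = complex_inner + complete_space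

instantiation complex :: complex_hilbert
begin

definition scaleC_complex :: "complex \<Rightarrow> complex \<Rightarrow> complex"
  where "scaleC_complex c x = c * x"

definition cinner_complex :: "complex \<Rightarrow> complex \<Rightarrow> complex"
  where "cinner_complex x y = x * cnj y"

instance
  by standard
    (auto simp: scaleC_complex_def cinner_complex_def algebra_simps scaleR_conv_of_real
      inner_complex_def)

end

(* Hilbert space direct sum; the norm and completeness on pairs are those of HOL-Analysis. *)
instantiation prod :: (complex_inner, complex_inner) complex_inner
begin

definition scaleC_prod :: "complex \<Rightarrow> 'a \<times> 'b \<Rightarrow> 'a \<times> 'b"
  where "scaleC_prod c p = (c *\<^sub>C fst p, c *\<^sub>C snd p)"

definition cinner_prod :: "'a \<times> 'b \<Rightarrow> 'a \<times> 'b \<Rightarrow> complex"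
  where "cinner_prod p q = cinner (fst p) (fst q) + cinner (snd p) (snd q)"

instance
proof
  fix p q :: "'a \<times> 'b"
  show "cinner p q = cnj (cinner q p)"
    unfolding cinner_prod_def complex_cnj_add by (metis cinner_commute)
qed (auto simp: scaleC_prod_def cinner_prod_def inner_prod_def scaleC_add_right scaleC_add_left
      scaleC_scaleC scaleC_one scaleR_scaleC cinner_add_left cinner_scaleC_left
      inner_eq_Re_cinner scaleR_prod_def algebra_simps)

end

instance prod :: (complex_hilbert, complex_hilbert) complex_hilbert ..

definition bounded_clinear :: "('a::complex_inner \<Rightarrow> 'b::complex_inner) \<Rightarrow> bool"
  where "bounded_clinear T \<longleftrightarrow> bounded_linear T \<and> (\<forall>c x. T (c *\<^sub>C x) = c *\<^sub>C T x)"

definition positive_op :: "('a::complex_hilbert \<Rightarrow> 'a) \<Rightarrow> bool"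
  where "positive_op A \<longleftrightarrow> bounded_clinear A \<and> (\<forall>x. cinner (A x) x \<in> \<real>\<^sub>\<ge>\<^sub>0)"

definition A_inner :: "('a::complex_hilbert \<Rightarrow> 'a) \<Rightarrow> 'a \<Rightarrow> 'a \<Rightarrow> complex"
  where "A_inner A x y = cinner (A x) y"

definition A_norm :: "('a::complex_hilbert \<Rightarrow> 'a) \<Rightarrow> 'a \<Rightarrow> real"
  where "A_norm A x = sqrt (Re (A_inner A x x))"

definition A_adjoint :: "('a::complex_hilbert \<Rightarrow> 'a) \<Rightarrow> ('a \<Rightarrow> 'a) \<Rightarrow> ('a \<Rightarrow> 'a) \<Rightarrow> bool"
  where "A_adjoint A T R \<longleftrightarrow>
    bounded_clinear R \<and> (\<forall>x y. A_inner A (T x) y = A_inner A x (R y))"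

definition adjointable_ops :: "('a::complex_hilbert \<Rightarrow> 'a) \<Rightarrow> ('a \<Rightarrow> 'a) set"
  where "adjointable_ops A = {T. bounded_clinear T \<and> (\<exists>R. A_adjoint A T R)}"

(* Meant for positive A and T in adjointable_ops A, where this adjoint exists and is unique. *)
definition sharp :: "('a::complex_hilbert \<Rightarrow> 'a) \<Rightarrow> ('a \<Rightarrow> 'a) \<Rightarrow> ('a \<Rightarrow> 'a)"
  where "sharp A T = (THE S. A_adjoint A T S \<and> range S \<subseteq> closure (range A))"

(* Both suprema are over sets of nonnegative reals, which are bounded for T in
   adjointable_ops A. Inserting 0 only matters when the set is empty, that is for A = 0, where it
   fixes the convention that the supremum is 0 (Sup of the empty set of reals is unspecified). *)
definition A_opnorm :: "('a::complex_hilbert \<Rightarrow> 'a) \<Rightarrow> ('a \<Rightarrow> 'a) \<Rightarrow> real"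
  where "A_opnorm A T = Sup (insert 0 {A_norm A (T x) |x. A_norm A x = 1})"

definition A_num_radius :: "('a::complex_hilbert \<Rightarrow> 'a) \<Rightarrow> ('a \<Rightarrow> 'a) \<Rightarrow> real"
  where "A_num_radius A T = Sup (insert 0 {cmod (A_inner A (T x) x) |x. A_norm A x = 1})"

definition zero_op :: "'a::complex_hilbert \<Rightarrow> 'a"
  where "zero_op x = 0"

definition op_matrix ::
    "('a::complex_hilbert \<Rightarrow> 'a) \<Rightarrow> ('a \<Rightarrow> 'a) \<Rightarrow> ('a \<Rightarrow> 'a) \<Rightarrow> ('a \<Rightarrow> 'a) \<Rightarrow> 'a \<times> 'a \<Rightarrow> 'a \<times> 'a"
  where "op_matrix P Q R S = (\<lambda>(x, y). (P x + Q y, R x + S y))"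

end

theory Submission
  imports Defs
begin

text \<open>Split the operator matrix as \<open>D + E\<close> with \<open>D\<close> diagonal and \<open>E\<close> off-diagonal. For a \<open>B\<close>-unit
  vector \<open>u\<close>, expand \<open>(|\<langle>D u, u\<rangle>| + |\<langle>E u, u\<rangle>|)\<^sup>2\<close>; by Buzano's inequality and AM-GM the mixed term
  \<open>2 |\<langle>D u, u\<rangle>| |\<langle>u, E u\<rangle>|\<close> is at most
  \<open>1/2 (\<parallel>D u\<parallel>\<^sup>2 + \<parallel>E u\<parallel>\<^sup>2) + |\<langle>D u, E u\<rangle>|\<close>. Here \<open>\<langle>D u, E u\<rangle> = \<langle>E\<^sup>\<sharp> D u, u\<rangle>\<close>, and \<open>E\<^sup>\<sharp> D\<close> is the
  off-diagonal matrix of the theorem, while \<open>D\<^sup>\<sharp> D + E\<^sup>\<sharp> E\<close> is diagonal with entries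
  \<open>X\<^sup>\<sharp> X + Z\<^sup>\<sharp> Z\<close> and \<open>W\<^sup>\<sharp> W + Y\<^sup>\<sharp> Y\<close>.\<close>

subsection \<open>Orthogonal projection\<close>

text \<open>A minimizing sequence for the distance to \<open>x\<close> is Cauchy by the
  parallelogram law. Its limit is a closest point, and minimality along lines through it gives
  orthogonality.\<close>

lemma exists_orthogonal_projection:
  fixes M :: "'a::{real_inner, complete_space} set"
  assumes M: "subspace M" "closed M"
  shows "\<exists>p\<in>M. \<forall>m\<in>M. inner (x - p) m = 0"
proof -
  define \<delta> where "\<delta> = (INF m\<in>M. (norm (x - m))\<^sup>2)"
  have bdd: "bdd_below ((\<lambda>m. (norm (x - m))\<^sup>2) ` M)"
    by (rule bdd_belowI2[of _ 0]) simp
  have ne: "M \<noteq> {}"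
    using subspace_0[OF M(1)] by blast
  have \<delta>_le: "\<delta> \<le> (norm (x - m))\<^sup>2" if "m \<in> M" for m
    unfolding \<delta>_def using bdd that by (rule cINF_lower)
  have "\<exists>m\<in>M. (norm (x - m))\<^sup>2 < \<delta> + inverse (real (Suc n))" for n
  proof -
    have "(INF m\<in>M. (norm (x - m))\<^sup>2) < \<delta> + inverse (real (Suc n))"
      unfolding \<delta>_def by simp
    then show ?thesis
      using cINF_less_iff[OF ne bdd] by blast
  qed
  then obtain y where yM: "\<And>n. y n \<in> M"
    and y: "\<And>n. (norm (x - y n))\<^sup>2 < \<delta> + inverse (real (Suc n))"
    by metis
  have parallelogram: "(norm (a - b))\<^sup>2 = 2 * (norm (x - a))\<^sup>2 + 2 * (norm (x - b))\<^sup>2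
      - 4 * (norm (x - (1 / 2) *\<^sub>R (a + b)))\<^sup>2" for a b
    by (simp add: power2_norm_eq_inner inner_diff_left inner_diff_right inner_add_left
        inner_add_right inner_commute algebra_simps)
  have dist_y: "(norm (y m - y n))\<^sup>2 \<le> 2 * inverse (real (Suc m)) + 2 * inverse (real (Suc n))"
    for m n
  proof -
    \<comment> \<open>The midpoint is at squared distance at least \<open>\<delta>\<close> from
      \<open>x\<close>, so the terms \<open>4 * \<delta>\<close> cancel in the parallelogram
      law.\<close>
    have "(1 / 2) *\<^sub>R (y m + y n) \<in> M"
      by (intro subspace_scale subspace_add M yM)
    from \<delta>_le[OF this] show ?thesis
      using parallelogram[of "y m" "y n"] y[of m] y[of n] by simp
  qed
  have "Cauchy y"
  proof (rule metric_CauchyI)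
    fix e :: real
    assume e: "0 < e"
    obtain N where N: "inverse (real (Suc N)) < e\<^sup>2 / 4"
      using reals_Archimedean[of "e\<^sup>2 / 4"] e by auto
    have "dist (y m) (y n) < e" if "N \<le> m" "N \<le> n" for m n
    proof -
      have "inverse (real (Suc k)) \<le> inverse (real (Suc N))" if "N \<le> k" for k
        using that by (intro le_imp_inverse_le) auto
      from this[OF that(1)] this[OF that(2)] have "(norm (y m - y n))\<^sup>2 < e\<^sup>2"
        using dist_y[of m n] N by linarith
      then show ?thesis
        using e by (simp add: dist_norm power_less_imp_less_base)
    qed
    then show "\<exists>N. \<forall>m\<ge>N. \<forall>n\<ge>N. dist (y m) (y n) < e" by blast
  qed
  then obtain p where p: "y \<longlonglongrightarrow> p"
    using Cauchy_convergent_iff convergent_def by blast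
  have pM: "p \<in> M"
    using M(2) yM p closed_sequentially by blast
  have "(norm (x - p))\<^sup>2 \<le> \<delta> + 0"
  proof (rule LIMSEQ_le)
    show "(\<lambda>n. (norm (x - y n))\<^sup>2) \<longlonglongrightarrow> (norm (x - p))\<^sup>2"
      by (intro tendsto_intros p)
    show "(\<lambda>n. \<delta> + inverse (real (Suc n))) \<longlonglongrightarrow> \<delta> + 0"
      by (intro tendsto_intros LIMSEQ_inverse_real_of_nat)
    show "\<exists>N. \<forall>n\<ge>N. (norm (x - y n))\<^sup>2 \<le> \<delta> + inverse (real (Suc n))"
      using y less_imp_le by blast
  qed
  then have closest: "(norm (x - p))\<^sup>2 \<le> (norm (x - m))\<^sup>2" if "m \<in> M" for m
    using \<delta>_le[OF that] by linarith
  have "inner (x - p) m = 0" if m: "m \<in> M" for m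
  proof (cases "m = 0")
    case False
    \<comment> \<open>Moving from \<open>p\<close> by this multiple of \<open>m\<close> minimizes
      the distance to \<open>x\<close> along the line, so any nonzero inner product would contradict
      \<open>closest\<close>.\<close>
    define t where "t = inner (x - p) m / inner m m"
    have "p + t *\<^sub>R m \<in> M"
      by (intro subspace_scale subspace_add M pM m)
    from closest[OF this] have "2 * t * inner (x - p) m \<le> t * t * inner m m"
      by (simp add: power2_norm_eq_inner inner_diff_left inner_diff_right inner_add_left
          inner_add_right inner_commute algebra_simps)
    then have "(inner (x - p) m)\<^sup>2 / inner m m \<le> 0"
      using False by (simp add: t_def power2_eq_square)
    moreover have "0 < inner m m"
      using False by simp
    ultimately show ?thesis
      by (auto simp: divide_le_0_iff simp del: inner_gt_zero_iff)
  qed simp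
  with pM show ?thesis by blast
qed

lemma subspace_closure:
  fixes M :: "'a::real_normed_vector set"
  assumes "subspace M"
  shows "subspace (closure M)"
proof (rule subspaceI)
  show "0 \<in> closure M"
    using subspace_0[OF assms] closure_subset by blast
  show "x + y \<in> closure M" if xy: "x \<in> closure M" "y \<in> closure M" for x y
  proof -
    obtain f g where "\<And>n. f n \<in> M" "f \<longlonglongrightarrow> x" "\<And>n. g n \<in> M" "g \<longlonglongrightarrow> y"
      using xy unfolding closure_sequential by blast
    then have "\<forall>n. f n + g n \<in> M" "(\<lambda>n. f n + g n) \<longlonglongrightarrow> x + y"
      by (auto intro: subspace_add[OF assms] tendsto_add)
    then show ?thesis
      unfolding closure_sequential by (intro exI conjI)
  qed
  show "c *\<^sub>R x \<in> closure M" if x: "x \<in> closure M" for c x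
  proof -
    obtain f where "\<And>n. f n \<in> M" "f \<longlonglongrightarrow> x"
      using x unfolding closure_sequential by blast
    then have "\<forall>n. c *\<^sub>R f n \<in> M" "(\<lambda>n. c *\<^sub>R f n) \<longlonglongrightarrow> c *\<^sub>R x"
      by (auto intro: subspace_scale[OF assms] tendsto_scaleR)
    then show ?thesis
      unfolding closure_sequential by (intro exI conjI)
  qed
qed

subsection \<open>Complex inner products and bounded operators\<close>

lemma cinner_add_right: "cinner x (y + z) = cinner x y + cinner x z"
  by (metis cinner_commute cinner_add_left complex_cnj_add)

lemma cinner_scaleC_right: "cinner x (c *\<^sub>C y) = cnj c * cinner x y"
  by (metis cinner_commute cinner_scaleC_left complex_cnj_mult)

lemma cinner_eq_zero_left: "(\<And>y. cinner x y = 0) \<Longrightarrow> x = 0"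
  by (metis inner_eq_Re_cinner inner_eq_zero_iff zero_complex.sel(1))

lemma bounded_clinearD:
  assumes "bounded_clinear T"
  shows "bounded_linear T" "T (x + y) = T x + T y" "T (c *\<^sub>C x) = c *\<^sub>C T x"
    "T (x - y) = T x - T y" "T 0 = 0"
  using assms unfolding bounded_clinear_def
  by (auto simp: bounded_linear.linear linear_add linear_diff linear_0)

lemma bounded_clinear_zero: "bounded_clinear (zero_op :: 'a::complex_hilbert \<Rightarrow> 'a)"
proof -
  have "c *\<^sub>C (0::'a) = 0" for c
    by (metis add_cancel_right_right scaleC_add_right add.left_neutral)
  then show ?thesis
    unfolding bounded_clinear_def zero_op_def by (auto intro: bounded_linear_zero)
qed

lemma bounded_clinear_comp:
  "bounded_clinear S \<Longrightarrow> bounded_clinear T \<Longrightarrow> bounded_clinear (S \<circ> T)"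
  unfolding bounded_clinear_def o_def by (auto intro: bounded_linear_compose)

lemma bounded_clinear_add:
  "bounded_clinear S \<Longrightarrow> bounded_clinear T \<Longrightarrow> bounded_clinear (\<lambda>x. S x + T x)"
  unfolding bounded_clinear_def by (auto intro: bounded_linear_add simp: scaleC_add_right)

lemma bounded_clinear_op_matrix:
  assumes "bounded_clinear P" "bounded_clinear Q" "bounded_clinear R" "bounded_clinear S"
  shows "bounded_clinear (op_matrix P Q R S)"
proof -
  have "bounded_linear (\<lambda>u. (P (fst u) + Q (snd u), R (fst u) + S (snd u)))"
    using assms[THEN bounded_clinearD(1)]
    by (intro bounded_linear_Pair bounded_linear_add)
      (auto intro: bounded_linear_compose bounded_linear_fst bounded_linear_snd)
  then show ?thesis
    using assms[THEN bounded_clinearD(3)] unfolding bounded_clinear_def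
    by (auto simp: op_matrix_def case_prod_beta' scaleC_prod_def scaleC_add_right)
qed


subsection \<open>The semi-inner product of a positive operator\<close>

locale positive_operator =
  fixes A :: "'a::complex_hilbert \<Rightarrow> 'a"
  assumes positive: "positive_op A"
begin

abbreviation ip :: "'a \<Rightarrow> 'a \<Rightarrow> complex" where "ip \<equiv> A_inner A"
abbreviation nm :: "'a \<Rightarrow> real" where "nm \<equiv> A_norm A"

lemma clinear_A: "bounded_clinear A"
  using positive unfolding positive_op_def by blast

lemmas A_simps = bounded_clinearD(2-5)[OF clinear_A]

lemma ip_add_left: "ip (x + y) z = ip x z + ip y z"
  by (simp add: A_inner_def A_simps cinner_add_left)

lemma ip_add_right: "ip x (y + z) = ip x y + ip x z"
  by (simp add: A_inner_def cinner_add_right)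

lemma ip_scaleC_left: "ip (c *\<^sub>C x) y = c * ip x y"
  by (simp add: A_inner_def A_simps cinner_scaleC_left)

lemma ip_scaleC_right: "ip x (c *\<^sub>C y) = cnj c * ip x y"
  by (simp add: A_inner_def cinner_scaleC_right)

lemmas ip_simps = ip_add_left ip_add_right ip_scaleC_left ip_scaleC_right

lemma ip_self: "0 \<le> Re (ip x x)" "Im (ip x x) = 0"
proof -
  have "ip x x \<in> \<real>\<^sub>\<ge>\<^sub>0"
    using positive unfolding positive_op_def A_inner_def by blast
  then show "0 \<le> Re (ip x x)" "Im (ip x x) = 0"
    by (simp_all add: complex_nonneg_Reals_iff)
qed

text \<open>Polarization: the form is real on the diagonal, so \<open>x + y\<close> gives the
  imaginary parts of the identity and \<open>x + \<i> *\<^sub>C y\<close> the real parts.\<close>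

lemma ip_commute: "ip x y = cnj (ip y x)"
  using ip_self(2)[of "x + y"] ip_self(2)[of "x + \<i> *\<^sub>C y"] ip_self(2)[of x] ip_self(2)[of y]
  by (simp add: ip_simps complex_eq_iff)

lemma ip_diff_left: "ip (x - y) z = ip x z - ip y z"
  using ip_add_left[of "x - y" y z] by simp

lemma ip_diff_right: "ip x (y - z) = ip x y - ip x z"
  using ip_add_right[of x "y - z" z] by simp

lemma cinner_A: "cinner (A x) y = cinner x (A y)"
  using ip_commute[of x y] cinner_commute[of x "A y"] by (simp add: A_inner_def)

lemma nm_nonneg: "0 \<le> nm x"
  by (simp add: A_norm_def ip_self)

lemma nm_sq: "(nm x)\<^sup>2 = Re (ip x x)"
  by (simp add: A_norm_def ip_self)

lemma ip_self_eq: "ip x x = of_real ((nm x)\<^sup>2)"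
  by (simp add: nm_sq complex_eq_iff ip_self)

text \<open>The usual quadratic in \<open>t\<close>, with separate treatment of vectors
  \<open>y\<close> of seminorm zero, which may be nonzero.\<close>

lemma cauchy_schwarz: "cmod (ip x y) \<le> nm x * nm y"
proof -
  define p where "p = ip x y"
  have expand: "0 \<le> (nm x)\<^sup>2 - 2 * t * (cmod p)\<^sup>2 + t\<^sup>2 * (cmod p)\<^sup>2 * (nm y)\<^sup>2" for t
  proof -
    define c where "c = of_real t * p"
    have "ip (x - c *\<^sub>C y) (x - c *\<^sub>C y)
        = ip x x - cnj c * p - c * cnj p + c * cnj c * ip y y"
      using ip_commute[of y x]
      by (simp add: ip_diff_left ip_diff_right ip_simps p_def algebra_simps)
    also have "Re \<dots> = (nm x)\<^sup>2 - 2 * t * (cmod p)\<^sup>2 + t\<^sup>2 * (cmod p)\<^sup>2 * (nm y)\<^sup>2"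
      unfolding cmod_power2 by (simp add: c_def ip_self_eq power2_eq_square algebra_simps)
    finally show ?thesis
      using ip_self(1)[of "x - c *\<^sub>C y"] by simp
  qed
  have "(cmod p)\<^sup>2 \<le> (nm x)\<^sup>2 * (nm y)\<^sup>2"
  proof (cases "nm y = 0")
    case True
    have "p = 0"
    proof (rule ccontr)
      assume "p \<noteq> 0"
      then show False
        \<comment> \<open>With this \<open>t\<close> the right-hand side of \<open>expand\<close>
          equals -1.\<close>
        using expand[of "((nm x)\<^sup>2 + 1) / (2 * (cmod p)\<^sup>2)"] True by simp
    qed
    then show ?thesis by simp
  next
    case False
    then have "1 / (nm y)\<^sup>2 * (cmod p)\<^sup>2 \<le> (nm x)\<^sup>2"
      \<comment> \<open>This \<open>t\<close> minimizes the quadratic.\<close>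
      using expand[of "1 / (nm y)\<^sup>2"] by (simp add: power2_eq_square)
    then show ?thesis
      using False by (simp add: field_simps)
  qed
  then show ?thesis
    unfolding p_def power_mult_distrib[symmetric]
    by (rule power2_le_imp_le) (simp add: nm_nonneg)
qed

text \<open>Buzano's inequality: the vector \<open>2 \<langle>a, e\<rangle> e - a\<close>, a reflection of \<open>a\<close>, has the same seminorm
  as \<open>a\<close>, so it suffices to apply Cauchy--Schwarz to it and \<open>b\<close>.\<close>

lemma buzano:
  assumes e: "nm e = 1"
  shows "2 * (cmod (ip a e) * cmod (ip e b)) \<le> nm a * nm b + cmod (ip a b)"
proof -
  define a' where "a' = (2 * ip a e) *\<^sub>C e - a"
  have ee: "ip e e = 1"
    by (simp add: ip_self_eq e)
  have "ip a' a' = ip a a"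
    using ip_commute[of e a]
    by (simp add: a'_def ip_diff_left ip_diff_right ip_simps ee algebra_simps)
  then have nm_a': "nm a' = nm a"
    by (simp add: A_norm_def)
  have "2 * (cmod (ip a e) * cmod (ip e b)) = cmod (ip a' b + ip a b)"
    by (simp add: a'_def ip_diff_left ip_simps norm_mult)
  also have "\<dots> \<le> cmod (ip a' b) + cmod (ip a b)"
    by (rule norm_triangle_ineq)
  also have "cmod (ip a' b) \<le> nm a * nm b"
    using cauchy_schwarz[of a' b] by (simp add: nm_a')
  finally show ?thesis by simp
qed

subsection \<open>Existence and uniqueness of the distinguished adjoint\<close>

text \<open>Self-adjointness of \<open>A\<close> makes its kernel orthogonal to its range, and
  orthogonality to a fixed vector is a closed condition.\<close>

lemma kernel_orthogonal_closure_range: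
  assumes p: "A p = 0" and z: "z \<in> closure (range A)"
  shows "inner p z = 0"
proof -
  have "inner p (A w) = 0" for w
    using p by (metis cinner_A inner_eq_Re_cinner inner_zero_left)
  then have "range A \<subseteq> {w. inner p w = 0}" by auto
  moreover have "closed {w. inner p w = 0}"
    by (intro closed_Collect_eq continuous_intros)
  ultimately show ?thesis
    using z closure_minimal by blast
qed

text \<open>The difference lies in the kernel of \<open>A\<close>, hence is orthogonal to
  \<open>p\<close> and \<open>q\<close> and so to itself. This injectivity yields both the linearity
  of the projection below and the uniqueness of the distinguished adjoint.\<close>

lemma eq_on_closure_range:
  assumes "p \<in> closure (range A)" "q \<in> closure (range A)" "A p = A q"
  shows "p = q"
proof -
  have "inner (p - q) p = 0" "inner (p - q) q = 0"
    using assms by (auto intro!: kernel_orthogonal_closure_range simp: A_simps)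
  then have "inner (p - q) (p - q) = 0"
    by (simp add: inner_diff_right)
  then show ?thesis by simp
qed

text \<open>\<open>subspace\<close> is a real notion, so closure under complex scalars is shown
  separately, by continuity of scaling.\<close>

lemma closure_range_closed_under:
  shows "subspace (closure (range A))"
    and "z \<in> closure (range A) \<Longrightarrow> c *\<^sub>C z \<in> closure (range A)"
proof -
  have "subspace (range A)"
    using subspace_UNIV clinear_A by (metis bounded_clinearD(1) bounded_linear.linear linear_subspace_image)
  then show "subspace (closure (range A))"
    by (rule subspace_closure)
  assume "z \<in> closure (range A)"
  then obtain f where f: "\<And>n. f n \<in> range A" "f \<longlonglongrightarrow> z"
    unfolding closure_sequential by blast
  have "norm (c *\<^sub>C x) = cmod c * norm x" for x :: 'a
  proof -
    have "inner (c *\<^sub>C x) (c *\<^sub>C x) = (cmod c)\<^sup>2 * inner x x"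
      unfolding cmod_power2 using cinner_commute[of x x]
      by (simp add: inner_eq_Re_cinner cinner_scaleC_left cinner_scaleC_right
          complex_eq_iff power2_eq_square algebra_simps)
    then show ?thesis
      by (simp add: norm_eq_sqrt_inner real_sqrt_mult)
  qed
  then have "bounded_linear (\<lambda>x::'a. c *\<^sub>C x)"
    by (intro bounded_linear_intro[of _ "cmod c"])
      (simp_all add: scaleC_add_right scaleR_scaleC scaleC_scaleC mult.commute)
  then have "(\<lambda>n. c *\<^sub>C f n) \<longlonglongrightarrow> c *\<^sub>C z"
    using f(2) by (rule bounded_linear.tendsto)
  moreover have "\<forall>n. c *\<^sub>C f n \<in> range A"
    using f(1) by (metis A_simps(2) rangeE rangeI)
  ultimately show "c *\<^sub>C z \<in> closure (range A)"
    unfolding closure_sequential by (intro exI conjI)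
qed

text \<open>\<open>P\<close> is the orthogonal projection onto the closure of the range; it only
  changes a vector by an element of the kernel of \<open>A\<close>.\<close>

lemma exists_projection:
  "\<exists>P. bounded_clinear P \<and> range P \<subseteq> closure (range A) \<and> (\<forall>x. A (P x) = A x)"
proof -
  note sub = closure_range_closed_under
  have "\<exists>p. p \<in> closure (range A) \<and> A p = A x \<and> norm p \<le> norm x" for x
  proof -
    obtain p where p: "p \<in> closure (range A)"
      and orth: "\<And>m. m \<in> closure (range A) \<Longrightarrow> inner (x - p) m = 0"
      using exists_orthogonal_projection[OF sub(1) closed_closure, of x] by blast
    \<comment> \<open>Self-adjointness moves one \<open>A\<close> to the right, where the vector
      lies in the range and is thus orthogonal to \<open>x - p\<close>.\<close>
    have "inner (A (x - p)) (A (x - p)) = inner (x - p) (A (A (x - p)))"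
      by (simp only: inner_eq_Re_cinner cinner_A)
    also have "\<dots> = 0"
      by (intro orth closure_subset[THEN subsetD]) blast
    finally have "A p = A x"
      by (simp add: A_simps)
    moreover have "inner p p = inner x p"
      using orth[OF p] by (simp add: inner_diff_left)
    then have "norm p * norm p \<le> norm x * norm p"
      using norm_cauchy_schwarz[of x p] by (simp add: power2_norm_eq_inner[symmetric] power2_eq_square)
    then have "norm p \<le> norm x"
      by (cases "p = 0") auto
    ultimately show ?thesis
      using p by blast
  qed
  then obtain P where P: "\<And>x. P x \<in> closure (range A)" "\<And>x. A (P x) = A x"
    "\<And>x. norm (P x) \<le> norm x"
    by metis
  \<comment> \<open>Both sides lie in the closure of the range and have the same image under
    \<open>A\<close>; additivity follows in the same way.\<close>
  have scaleC: "P (c *\<^sub>C x) = c *\<^sub>C P x" for c x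
    by (rule eq_on_closure_range) (simp_all add: P sub A_simps)
  have "bounded_linear P"
  proof (rule bounded_linear_intro)
    show "P (x + y) = P x + P y" for x y
      by (rule eq_on_closure_range) (simp_all add: P A_simps subspace_add[OF sub(1)])
    show "P (r *\<^sub>R x) = r *\<^sub>R P x" for r x
      by (simp add: scaleR_scaleC scaleC)
    show "norm (P x) \<le> norm x * 1" for x
      by (simp add: P)
  qed
  with P scaleC show ?thesis
    unfolding bounded_clinear_def by blast
qed

text \<open>Composing any adjoint \<open>R\<close> with the projection \<open>P\<close> keeps it an
  adjoint and puts its range where \<open>sharp\<close> demands; injectivity of \<open>A\<close>
  there makes the definite description well defined.\<close>

lemma sharp_adjoint:
  assumes "T \<in> adjointable_ops A"
  shows "A_adjoint A T (sharp A T)"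
proof -
  obtain R where R: "bounded_clinear R" "\<And>x y. ip (T x) y = ip x (R y)"
    using assms unfolding adjointable_ops_def A_adjoint_def by blast
  obtain P where P: "bounded_clinear P" "range P \<subseteq> closure (range A)" "\<And>x. A (P x) = A x"
    using exists_projection by blast
  have adj: "A_adjoint A T (P \<circ> R)"
    using R P by (simp add: A_adjoint_def bounded_clinear_comp A_inner_def cinner_A)
  have range: "range (P \<circ> R) \<subseteq> closure (range A)"
    using P(2) by auto
  have unique: "S = P \<circ> R" if S: "A_adjoint A T S" "range S \<subseteq> closure (range A)" for S
  proof
    fix y
    have "A (S y) - A ((P \<circ> R) y) = 0"
    proof (rule cinner_eq_zero_left)
      fix x
      have "ip x (S y) = ip x ((P \<circ> R) y)"
        using S(1) adj unfolding A_adjoint_def by metis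
      then have "ip (S y) x = ip ((P \<circ> R) y) x"
        by (metis ip_commute)
      then have "ip (S y - (P \<circ> R) y) x = 0"
        by (simp add: ip_diff_left)
      then show "cinner (A (S y) - A ((P \<circ> R) y)) x = 0"
        by (simp add: A_inner_def A_simps)
    qed
    then show "S y = (P \<circ> R) y"
      by (intro eq_on_closure_range[of "S y" "(P \<circ> R) y"] S(2)[THEN subsetD]
          range[THEN subsetD] rangeI) simp
  qed
  have "sharp A T = P \<circ> R"
    unfolding sharp_def
    by (rule the_equality, intro conjI adj range) (blast intro: unique)
  with adj show ?thesis by simp
qed

section \<open>Closure properties of the adjointable operators\<close>

lemma A_adjoint_swap:
  assumes "bounded_clinear T" "A_adjoint A T R"
  shows "A_adjoint A R T"
  using assms unfolding A_adjoint_def by (metis ip_commute)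

lemma sharp_adjointable:
  assumes "T \<in> adjointable_ops A"
  shows "sharp A T \<in> adjointable_ops A"
  using assms sharp_adjoint[OF assms] A_adjoint_swap
  unfolding adjointable_ops_def A_adjoint_def by blast

lemma ip_sharp_left:
  assumes "T \<in> adjointable_ops A"
  shows "ip (sharp A T x) y = ip x (T y)"
  using sharp_adjoint[OF assms] unfolding A_adjoint_def by (metis ip_commute)

lemma zero_adjointable: "zero_op \<in> adjointable_ops A"
proof -
  have "ip 0 y = 0" "ip y 0 = 0" for y
    using ip_diff_left[of 0 0 y] ip_diff_right[of y 0 0] by simp_all
  then have "A_adjoint A zero_op zero_op"
    by (simp add: A_adjoint_def bounded_clinear_zero zero_op_def)
  then show ?thesis
    unfolding adjointable_ops_def by (auto intro: bounded_clinear_zero)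
qed

lemma comp_adjointable:
  assumes "S \<in> adjointable_ops A" "T \<in> adjointable_ops A"
  shows "S \<circ> T \<in> adjointable_ops A"
proof -
  obtain S' T' where "A_adjoint A S S'" "A_adjoint A T T'"
    using assms unfolding adjointable_ops_def by blast
  then have "A_adjoint A (S \<circ> T) (T' \<circ> S')"
    by (simp add: A_adjoint_def bounded_clinear_comp)
  then show ?thesis
    using assms unfolding adjointable_ops_def by (blast intro: bounded_clinear_comp)
qed

lemma add_adjointable:
  assumes "S \<in> adjointable_ops A" "T \<in> adjointable_ops A"
  shows "(\<lambda>x. S x + T x) \<in> adjointable_ops A"
proof -
  obtain S' T' where "A_adjoint A S S'" "A_adjoint A T T'"
    using assms unfolding adjointable_ops_def by blast
  then have "A_adjoint A (\<lambda>x. S x + T x) (\<lambda>x. S' x + T' x)"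
    by (simp add: A_adjoint_def bounded_clinear_add ip_simps)
  then show ?thesis
    using assms unfolding adjointable_ops_def by (blast intro: bounded_clinear_add)
qed

subsection \<open>Boundedness of adjointable operators\<close>

text \<open>For the \<open>A\<close>-selfadjoint operator \<open>Q = R T\<close> the sequence \<open>q n = \<parallel>Q\<^sup>n x\<parallel>\<^sub>A\<close> is log-convex, so
  \<open>q 1 ^ n \<le> q n\<close> if \<open>q 0 = 1\<close>. As \<open>q n\<close> is bounded by a constant times the \<open>n\<close>-th power of the
  operator norm of \<open>Q\<close>, this bounds \<open>q 1\<close> independently of \<open>x\<close>.\<close>

lemma adjointable_bounded:
  assumes "T \<in> adjointable_ops A"
  shows "\<exists>K. \<forall>x. nm x = 1 \<longrightarrow> nm (T x) \<le> K"
proof -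
  obtain R where R: "bounded_clinear R" "\<And>x y. ip (T x) y = ip x (R y)"
    and T: "bounded_clinear T"
    using assms unfolding adjointable_ops_def A_adjoint_def by blast
  define Q where "Q = R \<circ> T"
  have sa: "ip (Q x) y = ip x (Q y)" for x y
    using R(2) by (metis Q_def comp_apply ip_commute)
  have "bounded_linear Q"
    unfolding Q_def using R(1) T by (intro bounded_clinearD(1) bounded_clinear_comp)
  then obtain M where M: "0 < M" "\<And>x. norm (Q x) \<le> norm x * M"
    using bounded_linear.pos_bounded by blast
  obtain L where L: "0 < L" "\<And>x. norm (A x) \<le> norm x * L"
    using bounded_linear.pos_bounded[OF bounded_clinearD(1)[OF clinear_A]] by blast
  \<comment> \<open>The seminorm is dominated by the Hilbert norm, which transfers the growth rate
    \<open>M ^ n\<close> of the iterates to \<open>q n\<close>.\<close>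
  have nm_le: "nm x \<le> sqrt L * norm x" for x
  proof -
    have "Re (ip x x) \<le> norm (A x) * norm x"
      unfolding A_inner_def inner_eq_Re_cinner[symmetric] by (rule norm_cauchy_schwarz)
    also have "\<dots> \<le> norm x * L * norm x"
      by (intro mult_right_mono L norm_ge_zero)
    also have "\<dots> = (sqrt L * norm x)\<^sup>2"
      using L(1) by (simp add: power_mult_distrib power2_eq_square)
    finally show ?thesis
      unfolding A_norm_def using L(1) by (intro real_le_lsqrt) (simp_all add: ip_self)
  qed
  have Q_le: "nm (Q x) \<le> M" if x: "nm x = 1" for x
  proof -
    define q where "q n = nm ((Q ^^ n) x)" for n
    have q_nonneg: "0 \<le> q n" for n
      by (simp add: q_def nm_nonneg)
    have log_convex: "(q (Suc n))\<^sup>2 \<le> q n * q (Suc (Suc n))" for n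
    proof -
      have "(q (Suc n))\<^sup>2 = Re (ip ((Q ^^ n) x) (Q (Q ((Q ^^ n) x))))"
        by (simp add: q_def nm_sq sa)
      also have "\<dots> \<le> cmod (ip ((Q ^^ n) x) (Q (Q ((Q ^^ n) x))))"
        by (rule complex_Re_le_cmod)
      also have "\<dots> \<le> q n * q (Suc (Suc n))"
        unfolding q_def using cauchy_schwarz by simp
      finally show ?thesis .
    qed
    \<comment> \<open>Log-convexity says that the ratios of consecutive terms do not decrease, and
      the first ratio is \<open>q 1\<close>. The product form avoids dividing by a vanishing
      term.\<close>
    have step: "q 1 * q n \<le> q (Suc n)" for n
    proof (induction n)
      case 0
      then show ?case
        using x by (simp add: q_def)
    next
      case (Suc n)
      show ?case
      proof (cases "q (Suc n) = 0")
        case True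
        then show ?thesis
          by (simp add: q_nonneg)
      next
        case False
        have "q 1 * (q (Suc n))\<^sup>2 \<le> q 1 * (q n * q (Suc (Suc n)))"
          by (intro mult_left_mono log_convex q_nonneg)
        also have "\<dots> = (q 1 * q n) * q (Suc (Suc n))"
          by simp
        also have "\<dots> \<le> q (Suc n) * q (Suc (Suc n))"
          by (intro mult_right_mono Suc q_nonneg)
        finally have "q (Suc n) * (q 1 * q (Suc n)) \<le> q (Suc n) * q (Suc (Suc n))"
          by (simp add: power2_eq_square algebra_simps)
        then show ?thesis
          using False q_nonneg[of "Suc n"] by simp
      qed
    qed
    have lower: "q 1 ^ n \<le> q n" for n
    proof (induction n)
      case 0
      then show ?case
        using x by (simp add: q_def)
    next
      case (Suc n)
      have "q 1 ^ Suc n \<le> q 1 * q n"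
        using Suc q_nonneg[of 1] by (simp add: mult_left_mono)
      then show ?case
        using step[of n] by linarith
    qed
    have "norm ((Q ^^ n) x) \<le> norm x * M ^ n" for n
    proof (induction n)
      case (Suc n)
      have "norm ((Q ^^ Suc n) x) \<le> norm ((Q ^^ n) x) * M"
        using M(2) by simp
      also have "\<dots> \<le> norm x * M ^ n * M"
        using Suc M(1) by (intro mult_right_mono) auto
      finally show ?case
        by (simp add: algebra_simps)
    qed simp
    then have "q n \<le> sqrt L * (norm x * M ^ n)" for n
      using nm_le L(1) unfolding q_def
      by (meson order_trans mult_left_mono real_sqrt_ge_zero less_imp_le)
    with lower have "q 1 ^ n \<le> sqrt L * norm x * M ^ n" for n
      by (metis order_trans mult.assoc)
    then have bound: "(q 1 / M) ^ n \<le> sqrt L * norm x" for n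
      using M(1) by (simp add: power_divide pos_divide_le_eq)
    \<comment> \<open>Powers of a number above 1 would exceed the cap in \<open>bound\<close>. The
      cap depends on \<open>x\<close>, but the conclusion does not.\<close>
    have "q 1 \<le> M"
    proof (rule ccontr)
      assume "\<not> q 1 \<le> M"
      then have "1 < q 1 / M"
        using M(1) by simp
      then obtain n where "sqrt L * norm x < (q 1 / M) ^ n"
        using real_arch_pow by blast
      with bound[of n] show False by simp
    qed
    then show ?thesis
      by (simp add: q_def)
  qed
  have "nm (T x) \<le> sqrt M" if x: "nm x = 1" for x
  proof -
    \<comment> \<open>Since \<open>Q\<close> is \<open>R\<close> after \<open>T\<close>, the bound
      on \<open>Q\<close> controls the square of the seminorm of \<open>T x\<close>.\<close>
    have "(nm (T x))\<^sup>2 = Re (ip x (Q x))"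
      by (simp add: nm_sq R(2) Q_def)
    also have "\<dots> \<le> nm x * nm (Q x)"
      using cauchy_schwarz complex_Re_le_cmod order_trans by blast
    also have "\<dots> \<le> M"
      using Q_le[OF x] x by simp
    finally show ?thesis
      by (rule real_le_rsqrt)
  qed
  then show ?thesis by blast
qed

section \<open>The operator seminorm and the numerical radius as finite suprema\<close>

lemma opnorm_bdd_above:
  assumes "T \<in> adjointable_ops A"
  shows "bdd_above (insert 0 {nm (T x) |x. nm x = 1})"
proof -
  obtain K where K: "\<And>x. nm x = 1 \<Longrightarrow> nm (T x) \<le> K"
    using adjointable_bounded[OF assms] by blast
  show ?thesis
    by (rule bdd_aboveI[of _ "max 0 K"]) (auto simp: le_max_iff_disj dest: K)
qed

text \<open>Like \<open>opnorm_bdd_above\<close>, this makes \<open>cSup_upper\<close> applicable,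
  so that values at unit vectors are bounded by the supremum.\<close>

lemma num_radius_bdd_above:
  assumes "T \<in> adjointable_ops A"
  shows "bdd_above (insert 0 {cmod (ip (T x) x) |x. nm x = 1})"
proof -
  obtain K where K: "\<And>x. nm x = 1 \<Longrightarrow> nm (T x) \<le> K"
    using adjointable_bounded[OF assms] by blast
  have "cmod (ip (T x) x) \<le> K" if "nm x = 1" for x
    using cauchy_schwarz[of "T x" x] K[OF that] that by simp
  then show ?thesis
    by (intro bdd_aboveI[of _ "max 0 K"]) (auto simp: le_max_iff_disj)
qed

lemma opnorm_nonneg: "T \<in> adjointable_ops A \<Longrightarrow> 0 \<le> A_opnorm A T"
  unfolding A_opnorm_def by (rule cSup_upper[OF insertI1 opnorm_bdd_above])

lemma num_radius_nonneg: "T \<in> adjointable_ops A \<Longrightarrow> 0 \<le> A_num_radius A T"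
  unfolding A_num_radius_def by (rule cSup_upper[OF insertI1 num_radius_bdd_above])

lemma cmod_ip_scale:
  assumes "bounded_clinear T"
  shows "cmod (ip (T (of_real c *\<^sub>C x)) (of_real c *\<^sub>C x)) = c\<^sup>2 * cmod (ip (T x) x)"
  by (simp add: bounded_clinearD(3)[OF assms] ip_simps norm_mult power2_eq_square)

lemma nm_scale: "nm (of_real c *\<^sub>C x) = \<bar>c\<bar> * nm x"
  by (simp add: A_norm_def ip_simps real_sqrt_mult flip: mult.assoc)

text \<open>Normalizing \<open>x\<close> reduces to the definition; if its seminorm is zero,
  Cauchy-Schwarz makes the left side vanish.\<close>

lemma cmod_ip_le_num_radius:
  assumes T: "T \<in> adjointable_ops A"
  shows "cmod (ip (T x) x) \<le> A_num_radius A T * (nm x)\<^sup>2"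
proof (cases "nm x = 0")
  case True
  then show ?thesis
    using cauchy_schwarz[of "T x" x] by simp
next
  case False
  define u where "u = of_real (1 / nm x) *\<^sub>C x"
  have "nm u = 1"
    using False nm_nonneg[of x] by (simp only: u_def nm_scale) simp
  then have "cmod (ip (T u) u) \<le> A_num_radius A T"
    unfolding A_num_radius_def by (intro cSup_upper num_radius_bdd_above T) blast
  moreover have "bounded_clinear T"
    using T unfolding adjointable_ops_def by blast
  ultimately have "(1 / nm x)\<^sup>2 * cmod (ip (T x) x) \<le> A_num_radius A T"
    unfolding u_def by (simp only: cmod_ip_scale)
  then show ?thesis
    using False by (simp add: power_divide divide_le_eq)
qed

lemma num_radius_le_opnorm:
  assumes T: "T \<in> adjointable_ops A"
  shows "A_num_radius A T \<le> A_opnorm A T"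
  unfolding A_num_radius_def
proof (rule cSup_least)
  fix v
  assume "v \<in> insert 0 {cmod (ip (T x) x) |x. nm x = 1}"
  then consider "v = 0" | x where "v = cmod (ip (T x) x)" "nm x = 1" by blast
  then show "v \<le> A_opnorm A T"
  proof cases
    case 2
    then have "v \<le> nm (T x)"
      using cauchy_schwarz[of "T x" x] by simp
    also have "\<dots> \<le> A_opnorm A T"
      unfolding A_opnorm_def using 2(2) by (intro cSup_upper opnorm_bdd_above T) blast
    finally show ?thesis .
  qed (simp add: opnorm_nonneg[OF T])
qed simp

text \<open>The left side is the quadratic form at \<open>x\<close> of the operator on the right,
  whose numerical radius is at most its seminorm.\<close>

lemma sum_nm_sq_le_opnorm:
  assumes S: "S \<in> adjointable_ops A" and T: "T \<in> adjointable_ops A"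
  shows "(nm (S x))\<^sup>2 + (nm (T x))\<^sup>2
    \<le> A_opnorm A (\<lambda>x. sharp A S (S x) + sharp A T (T x)) * (nm x)\<^sup>2"
proof -
  let ?G = "\<lambda>x. sharp A S (S x) + sharp A T (T x)"
  have G: "?G \<in> adjointable_ops A"
    using add_adjointable[OF comp_adjointable[OF sharp_adjointable[OF S] S]
        comp_adjointable[OF sharp_adjointable[OF T] T]] by simp
  have "(nm (S x))\<^sup>2 + (nm (T x))\<^sup>2 = Re (ip (?G x) x)"
    by (simp add: nm_sq ip_add_left ip_sharp_left S T)
  also have "\<dots> \<le> A_num_radius A ?G * (nm x)\<^sup>2"
    using cmod_ip_le_num_radius[OF G] complex_Re_le_cmod order_trans by blast
  also have "\<dots> \<le> A_opnorm A ?G * (nm x)\<^sup>2"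
    by (intro mult_right_mono num_radius_le_opnorm G) simp
  finally show ?thesis .
qed

subsection \<open>Operator matrices\<close>

abbreviation AA :: "'a \<times> 'a \<Rightarrow> 'a \<times> 'a" where "AA \<equiv> op_matrix A zero_op zero_op A"

lemma A_inner_AA: "A_inner AA u v = ip (fst u) (fst v) + ip (snd u) (snd v)"
  by (simp add: A_inner_def cinner_prod_def op_matrix_def zero_op_def case_prod_beta')

lemma A_norm_AA: "(A_norm AA u)\<^sup>2 = (nm (fst u))\<^sup>2 + (nm (snd u))\<^sup>2"
  by (simp add: A_norm_def[of AA] A_inner_AA nm_sq ip_self)

text \<open>This makes the locale available for the direct sum, so Buzano's inequality and the
  bounds on suprema apply there too.\<close>

lemma positive_operator_AA: "positive_operator AA"
proof
  have "bounded_clinear AA"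
    by (intro bounded_clinear_op_matrix clinear_A bounded_clinear_zero)
  moreover have "A_inner AA u u \<in> \<real>\<^sub>\<ge>\<^sub>0" for u
    by (simp add: A_inner_AA complex_nonneg_Reals_iff ip_self)
  ultimately show "positive_op AA"
    unfolding positive_op_def A_inner_def by blast
qed

text \<open>An adjoint is the transposed matrix of entrywise adjoints.\<close>

lemma op_matrix_adjointable:
  assumes "P \<in> adjointable_ops A" "Q \<in> adjointable_ops A"
    "R \<in> adjointable_ops A" "S \<in> adjointable_ops A"
  shows "op_matrix P Q R S \<in> adjointable_ops AA"
proof -
  obtain P' Q' R' S' where
    "A_adjoint A P P'" "A_adjoint A Q Q'" "A_adjoint A R R'" "A_adjoint A S S'"
    using assms unfolding adjointable_ops_def by blast
  then have "A_adjoint AA (op_matrix P Q R S) (op_matrix P' R' Q' S')"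
    unfolding A_adjoint_def A_inner_AA
    by (auto simp: op_matrix_def case_prod_beta' ip_simps
        intro: bounded_clinear_op_matrix[unfolded op_matrix_def case_prod_beta'])
  moreover have "bounded_clinear (op_matrix P Q R S)"
    using assms unfolding adjointable_ops_def by (blast intro: bounded_clinear_op_matrix)
  ultimately show ?thesis
    unfolding adjointable_ops_def by blast
qed

end

section \<open>The numerical radius inequality for operator matrices\<close>

theorem theorem3p4:
  fixes A X Y Z W :: "'a::complex_hilbert \<Rightarrow> 'a"
    and B :: "'a \<times> 'a \<Rightarrow> 'a \<times> 'a"
  assumes "positive_op A"
    and "B = op_matrix A zero_op zero_op A"
    and "X \<in> adjointable_ops A" and "Y \<in> adjointable_ops A"
    and "Z \<in> adjointable_ops A" and "W \<in> adjointable_ops A"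
  shows "(A_num_radius B (op_matrix X Y Z W))\<^sup>2 \<le>
      max ((A_num_radius A X)\<^sup>2) ((A_num_radius A W)\<^sup>2)
      + (A_num_radius B (op_matrix zero_op Y Z zero_op))\<^sup>2
      + A_num_radius B (op_matrix zero_op (sharp A Z \<circ> W) (sharp A Y \<circ> X) zero_op)
      + 1 / 2 * max (A_opnorm A (\<lambda>x. sharp A X (X x) + sharp A Z (Z x)))
                    (A_opnorm A (\<lambda>x. sharp A W (W x) + sharp A Y (Y x)))"
proof -
  interpret A: positive_operator A
    by (rule positive_operator.intro) fact
  note B = assms(2) and adj = assms(3-6)
  interpret B: positive_operator B
    unfolding B by (rule A.positive_operator_AA)
  let ?T = "op_matrix X Y Z W"
  let ?D = "op_matrix X zero_op zero_op W"
  let ?E = "op_matrix zero_op Y Z zero_op"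
  let ?F = "op_matrix zero_op (sharp A Z \<circ> W) (sharp A Y \<circ> X) zero_op"
  let ?r = "max (A_num_radius A X) (A_num_radius A W)"
  let ?N = "max (A_opnorm A (\<lambda>x. sharp A X (X x) + sharp A Z (Z x)))
    (A_opnorm A (\<lambda>x. sharp A W (W x) + sharp A Y (Y x)))"
  let ?bound = "?r\<^sup>2 + (A_num_radius B ?E)\<^sup>2 + A_num_radius B ?F + 1 / 2 * ?N"
  note matrix_adj = A.op_matrix_adjointable[folded B]
  have T: "?T \<in> adjointable_ops B" and E: "?E \<in> adjointable_ops B"
    and F: "?F \<in> adjointable_ops B"
    by (intro matrix_adj adj A.zero_adjointable A.comp_adjointable A.sharp_adjointable)+
  have nonneg: "0 \<le> A_num_radius A X" "0 \<le> A_num_radius A W"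
    by (intro A.num_radius_nonneg adj)+
  \<comment> \<open>With the maximum inside the square, it suffices to bound the diagonal term
    itself by \<open>?r\<close>.\<close>
  have max_sq: "max ((A_num_radius A X)\<^sup>2) ((A_num_radius A W)\<^sup>2) = ?r\<^sup>2"
    using nonneg by (auto simp: max_def power2_le_iff_abs_le abs_le_square_iff[symmetric])
  have inner_B: "A_inner B u v = A_inner A (fst u) (fst v) + A_inner A (snd u) (snd v)"
    and norm_B: "(A_norm B u)\<^sup>2 = (A_norm A (fst u))\<^sup>2 + (A_norm A (snd u))\<^sup>2" for u v
    unfolding B by (rule A.A_inner_AA, rule A.A_norm_AA)
  have unit_bound: "(cmod (A_inner B (?T u) u))\<^sup>2 \<le> ?bound" if u: "A_norm B u = 1" for u
  proof -
    have u1: "(A_norm A (fst u))\<^sup>2 + (A_norm A (snd u))\<^sup>2 = 1"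
      using norm_B[of u] u by simp
    \<comment> \<open>The squared seminorms of the components are weights with sum 1. This produces
      both maxima of the theorem: of numerical radii and of operator seminorms.\<close>
    have avg: "a * (A_norm A (fst u))\<^sup>2 + b * (A_norm A (snd u))\<^sup>2 \<le> max a b" for a b :: real
    proof -
      have "a * (A_norm A (fst u))\<^sup>2 + b * (A_norm A (snd u))\<^sup>2
          \<le> max a b * (A_norm A (fst u))\<^sup>2 + max a b * (A_norm A (snd u))\<^sup>2"
        by (intro add_mono mult_right_mono) auto
      also have "\<dots> = max a b"
        using u1 by (simp flip: distrib_left)
      finally show ?thesis .
    qed
    define d where "d = cmod (A_inner B (?D u) u)"
    define e where "e = cmod (A_inner B (?E u) u)"
    have "A_inner B (?T u) u = A_inner B (?D u) u + A_inner B (?E u) u"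
      by (simp flip: B.ip_add_left) (simp add: op_matrix_def zero_op_def case_prod_beta' add.commute)
    then have "cmod (A_inner B (?T u) u) \<le> d + e"
      unfolding d_def e_def by (simp add: norm_triangle_ineq)
    then have "(cmod (A_inner B (?T u) u))\<^sup>2 \<le> (d + e)\<^sup>2"
      by (intro power_mono) auto
    also have "\<dots> = d\<^sup>2 + e\<^sup>2 + 2 * (d * e)"
      by (simp add: power2_eq_square algebra_simps)
    also have "d\<^sup>2 \<le> ?r\<^sup>2"
    proof (rule power_mono)
      have "d \<le> cmod (A_inner A (X (fst u)) (fst u)) + cmod (A_inner A (W (snd u)) (snd u))"
        by (simp add: d_def inner_B op_matrix_def zero_op_def case_prod_beta' norm_triangle_ineq)
      also have "\<dots> \<le> A_num_radius A X * (A_norm A (fst u))\<^sup>2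
          + A_num_radius A W * (A_norm A (snd u))\<^sup>2"
        by (intro add_mono A.cmod_ip_le_num_radius adj)
      also have "\<dots> \<le> ?r"
        by (rule avg)
      finally show "d \<le> ?r" .
    qed (simp add: d_def)
    also have "e\<^sup>2 \<le> (A_num_radius B ?E)\<^sup>2"
      using B.cmod_ip_le_num_radius[OF E, of u] u by (simp add: e_def power_mono)
    also have "2 * (d * e) \<le> A_num_radius B ?F + 1 / 2 * ?N"
    proof -
      \<comment> \<open>Buzano's inequality needs \<open>u\<close> as the left argument here;
        swapping only conjugates.\<close>
      have "e = cmod (A_inner B u (?E u))"
        unfolding e_def by (metis B.ip_commute complex_mod_cnj)
      then have "2 * (d * e) \<le> A_norm B (?D u) * A_norm B (?E u) + cmod (A_inner B (?D u) (?E u))"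
        using B.buzano[OF u, of "?D u" "?E u"] by (simp add: d_def)
      moreover have "cmod (A_inner B (?D u) (?E u)) \<le> A_num_radius B ?F"
      proof -
        \<comment> \<open>\<open>?E\<close> exchanges the components, so \<open>X (fst u)\<close> is
          paired with \<open>Y (snd u)\<close> and \<open>W (snd u)\<close> with
          \<open>Z (fst u)\<close>; moving \<open>Y\<close> and \<open>Z\<close> to the left gives
          the entries of \<open>?F\<close>.\<close>
        have "A_inner B (?D u) (?E u) = A_inner B (?F u) u"
          by (simp add: inner_B op_matrix_def zero_op_def case_prod_beta' A.ip_sharp_left adj)
        then show ?thesis
          using B.cmod_ip_le_num_radius[OF F, of u] u by simp
      qed
      moreover have "2 * (A_norm B (?D u) * A_norm B (?E u)) \<le> ?N"
      proof -
        have "2 * (A_norm B (?D u) * A_norm B (?E u))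
            \<le> (A_norm B (?D u))\<^sup>2 + (A_norm B (?E u))\<^sup>2"
          using sum_squares_bound[of "A_norm B (?D u)" "A_norm B (?E u)"]
          by (simp add: mult.assoc)
        \<comment> \<open>Regrouping by component of \<open>u\<close> pairs \<open>X\<close> with
          \<open>Z\<close> and \<open>W\<close> with \<open>Y\<close>.\<close>
        also have "\<dots> = ((A_norm A (X (fst u)))\<^sup>2 + (A_norm A (Z (fst u)))\<^sup>2)
            + ((A_norm A (W (snd u)))\<^sup>2 + (A_norm A (Y (snd u)))\<^sup>2)"
          by (simp add: norm_B op_matrix_def zero_op_def case_prod_beta')
        also have "\<dots> \<le> A_opnorm A (\<lambda>x. sharp A X (X x) + sharp A Z (Z x)) * (A_norm A (fst u))\<^sup>2
            + A_opnorm A (\<lambda>x. sharp A W (W x) + sharp A Y (Y x)) * (A_norm A (snd u))\<^sup>2"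
          by (intro add_mono A.sum_nm_sq_le_opnorm adj)
        also have "\<dots> \<le> ?N"
          by (rule avg)
        finally show ?thesis .
      qed
      ultimately show ?thesis by simp
    qed
    finally show ?thesis by simp
  qed
  \<comment> \<open>One nonnegative argument suffices for \<open>?N\<close> to be
    nonnegative.\<close>
  have "0 \<le> A_opnorm A (\<lambda>x. sharp A X (X x) + sharp A Z (Z x))"
    using A.opnorm_nonneg[OF A.add_adjointable[OF
          A.comp_adjointable[OF A.sharp_adjointable[OF adj(1)] adj(1)]
          A.comp_adjointable[OF A.sharp_adjointable[OF adj(3)] adj(3)]]] by simp
  then have bound_nonneg: "0 \<le> ?bound"
    using B.num_radius_nonneg[OF F] by (intro add_nonneg_nonneg) auto
  \<comment> \<open>The supremum is bounded before squaring. \<open>bound_nonneg\<close> covers the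
    inserted 0, the only element when \<open>A\<close> is zero.\<close>
  have "A_num_radius B ?T \<le> sqrt ?bound"
    unfolding A_num_radius_def[of B ?T]
  proof (rule cSup_least)
    fix v
    assume "v \<in> insert 0 {cmod (A_inner B (?T u) u) |u. A_norm B u = 1}"
    then show "v \<le> sqrt ?bound"
      using unit_bound bound_nonneg by (auto intro!: real_le_rsqrt)
  qed simp
  then have "(A_num_radius B ?T)\<^sup>2 \<le> (sqrt ?bound)\<^sup>2"
    by (rule power_mono) (rule B.num_radius_nonneg[OF T])
  then show ?thesis
    using bound_nonneg by (simp add: max_sq)
qed

end
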